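(* For any positive integer $q$, a $\overline{3}$-separable $t\times n$ Boolean matrix that has a time-optimal analysis algorithm can be constructed with $t=2q^2-2q$ and $n=2^q$.
   Context: A $t\times n$ Boolean matrix $M$ models a non-adaptive group testing regimen: the $n$ columns correspond to items, the $t$ rows to tests, and a test includes exactly the items whose columns have a 1-entry in that row. All tests are conducted before the result of any test is available. Given an unknown set of defective items, the outcome of a test is positive if the test includes at least one defective item and negative otherwise. $M$ is $\overline{d}$-separable if the Boolean sums (entrywise OR) of up to $d$ columns are all distinct, so that each selection of up to $d$ defective items induces a different set of positive tests. An analysis algorithm uses the results of the $t$ tests to determine which of the $n$ items are defective (here, when it is known that at most three are defective). Let $A(n,t)$ denote the analysis time needed to determine which items are defective, where $n$ is the number of items and $t$ the number of tests conducted. The analysis algorithm is time-optimal if $A(n,t)$ is $O(t)$.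
   Formalization: The case q = 1 is excluded (the formal theorem takes q ≥ 2): there t = 0 and n = 2, and no matrix with zero tests can separate two items, so the statement fails. *)

theory Defs
  imports "Jordan_Normal_Form.Matrix" "HOL-Library.Landau_Symbols"
begin

definition selections :: "nat \<Rightarrow> bool mat \<Rightarrow> nat set set" where
  "selections d M = {D. D \<subseteq> {..<dim_col M} \<and> card D \<le> d}"

text \<open>The Boolean sum of the columns indexed by \<open>D\<close>. Read as a vector of test outcomes, entry
  \<open>i\<close> says whether test \<open>i\<close> is positive when \<open>D\<close> is the set of defective items.\<close>

definition boolean_sum :: "bool mat \<Rightarrow> nat set \<Rightarrow> bool vec" where
  "boolean_sum M D = vec (dim_row M) (\<lambda>i. \<exists>j\<in>D. M $$ (i, j))"

definition bar_separable :: "nat \<Rightarrow> bool mat \<Rightarrow> bool" where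
  "bar_separable d M \<longleftrightarrow> inj_on (boolean_sum M) (selections d M)"

text \<open>No matrix with 0 rows and 2 columns is separable, so the parameters \<open>t = 2 * q^2 - 2 * q\<close>,
  \<open>n = 2 ^ q\<close> are not attainable for \<open>q = 1\<close>.\<close>

lemma not_bar_separable_1:
  assumes "M \<in> carrier_mat (2 * 1\<^sup>2 - 2 * 1) (2 ^ 1)"
  shows "\<not> bar_separable 3 M"
proof
  assume "bar_separable 3 M"
  moreover have "boolean_sum M {0} = boolean_sum M {1}"
    using assms by (auto simp: boolean_sum_def)
  moreover have "{0} \<in> selections 3 M" "{1} \<in> selections 3 M"
    using assms by (auto simp: selections_def)
  ultimately have "{0} = {1::nat}"
    unfolding bar_separable_def by (rule inj_onD)
  then show False by simp
qed

text \<open>Analysis algorithms are while programs for a random access machine with the uniform cost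
  measure. The machine has registers and a memory with indirect addressing, both holding natural
  numbers and both indexed by natural numbers. Its only arithmetic operations are addition and
  truncated subtraction, so unit cost per instruction does not hide expensive computations.
  Branches and loops test whether a register is nonzero.\<close>

datatype com =
    Const nat nat
  | Add nat nat nat
  | Sub nat nat nat
  | Load nat nat
  | Store nat nat
  | Seq com com
  | If nat com com
  | While nat com

type_synonym state = "(nat \<Rightarrow> nat) \<times> (nat \<Rightarrow> nat)"

text \<open>\<open>exec c s k s'\<close>: started in \<open>s\<close>, the program \<open>c\<close> terminates in \<open>s'\<close> after \<open>k\<close> steps, where
  every instruction and every evaluation of a branch or loop condition is one step.\<close>

inductive exec :: "com \<Rightarrow> state \<Rightarrow> nat \<Rightarrow> state \<Rightarrow> bool" where
  Const: "exec (Const x a) (r, m) 1 (r(x := a), m)"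
| Add: "exec (Add x y z) (r, m) 1 (r(x := r y + r z), m)"
| Sub: "exec (Sub x y z) (r, m) 1 (r(x := r y - r z), m)"
| Load: "exec (Load x y) (r, m) 1 (r(x := m (r y)), m)"
| Store: "exec (Store x y) (r, m) 1 (r, m(r x := r y))"
| Seq: "exec c1 s k1 s' \<Longrightarrow> exec c2 s' k2 s'' \<Longrightarrow> exec (Seq c1 c2) s (k1 + k2) s''"
| IfTrue: "r x \<noteq> 0 \<Longrightarrow> exec c1 (r, m) k s' \<Longrightarrow> exec (If x c1 c2) (r, m) (k + 1) s'"
| IfFalse: "r x = 0 \<Longrightarrow> exec c2 (r, m) k s' \<Longrightarrow> exec (If x c1 c2) (r, m) (k + 1) s'"
| WhileFalse: "r x = 0 \<Longrightarrow> exec (While x c) (r, m) 1 (r, m)"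
| WhileTrue: "r x \<noteq> 0 \<Longrightarrow> exec c (r, m) k1 s' \<Longrightarrow> exec (While x c) s' k2 s'' \<Longrightarrow>
    exec (While x c) (r, m) (k1 + k2 + 1) s''"

inductive_cases exec_elims:
  "exec (Const x a) s k s'" "exec (Add x y z) s k s'" "exec (Sub x y z) s k s'"
  "exec (Load x y) s k s'" "exec (Store x y) s k s'" "exec (Seq c1 c2) s k s'"
  "exec (If x c1 c2) s k s'" "exec (While x c) s k s'"

lemma exec_deterministic:
  "exec c s k s' \<Longrightarrow> exec c s l u \<Longrightarrow> l = k \<and> u = s'"
proof (induction arbitrary: l u rule: exec.induct)
  case (Seq c1 s k1 s' c2 k2 s'')
  from Seq.prems obtain l1 l2 v where v: "exec c1 s l1 v" "exec c2 v l2 u" "l = l1 + l2"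
    by (rule exec_elims(6))
  from Seq.IH(1)[OF v(1)] have "l1 = k1" "v = s'" by simp_all
  with Seq.IH(2)[of l2 u] v show ?case by simp
next
  case (IfTrue r x c1 m k s' c2)
  from IfTrue.prems IfTrue.hyps(1) obtain l1 where l: "exec c1 (r, m) l1 u" "l = l1 + 1"
    by (cases rule: exec.cases) simp_all
  from IfTrue.IH[OF l(1)] l(2) show ?case by simp
next
  case (IfFalse r x c2 m k s' c1)
  from IfFalse.prems IfFalse.hyps(1) obtain l1 where l: "exec c2 (r, m) l1 u" "l = l1 + 1"
    by (cases rule: exec.cases) simp_all
  from IfFalse.IH[OF l(1)] l(2) show ?case by simp
next
  case (WhileFalse r x c m)
  from WhileFalse.prems WhileFalse.hyps show ?case
    by (cases rule: exec.cases) simp_all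
next
  case (WhileTrue r x c m k1 s' k2 s'')
  from WhileTrue.prems WhileTrue.hyps(1) obtain l1 l2 v
    where v: "exec c (r, m) l1 v" "exec (While x c) v l2 u" "l = l1 + l2 + 1"
    by (cases rule: exec.cases) simp_all
  from WhileTrue.IH(1)[OF v(1)] have "l1 = k1" "v = s'" by simp_all
  with WhileTrue.IH(2)[of l2 u] v show ?case by simp
qed (erule exec_elims; simp)+

definition running_time :: "com \<Rightarrow> state \<Rightarrow> nat" where
  "running_time c s = (THE k. \<exists>s'. exec c s k s')"

text \<open>The input consists of \<open>n\<close> (register 0), \<open>t\<close> (register 1) and the outcomes of the \<open>t\<close> tests
  (the first \<open>t\<close> memory cells). The number of rows and the number of columns are all the program
  is told about the matrix.\<close>

definition input_state :: "nat \<Rightarrow> bool vec \<Rightarrow> state" where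
  "input_state n v =
    ((\<lambda>_. 0)(0 := n, 1 := dim_vec v), \<lambda>i. if i < dim_vec v \<and> v $ i then 1 else 0)"

text \<open>The output is a list without repetitions: its length is in register 0, its entries are in the
  initial memory cells.\<close>

definition outputs :: "state \<Rightarrow> nat set \<Rightarrow> bool" where
  "outputs s D \<longleftrightarrow> (case s of (r, m) \<Rightarrow> bij_betw m {..<r 0} D)"

definition analysis_algorithm :: "nat \<Rightarrow> bool mat \<Rightarrow> com \<Rightarrow> bool" where
  "analysis_algorithm d M c \<longleftrightarrow> (\<forall>D\<in>selections d M. \<exists>k s'.
    exec c (input_state (dim_col M) (boolean_sum M D)) k s' \<and> outputs s' D)"

definition analysis_time :: "nat \<Rightarrow> bool mat \<Rightarrow> com \<Rightarrow> nat" where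
  "analysis_time d M c =
    Max ((\<lambda>D. running_time c (input_state (dim_col M) (boolean_sum M D))) ` selections d M)"

text \<open>Being \<open>O(t)\<close> is a property of a sequence of matrices with one common algorithm.\<close>

definition time_optimal :: "nat \<Rightarrow> (nat \<Rightarrow> bool mat) \<Rightarrow> com \<Rightarrow> bool" where
  "time_optimal d M c \<longleftrightarrow>
    (\<lambda>q. real (analysis_time d (M q) c)) \<in> O(\<lambda>q. real (dim_row (M q)))"

end

theory Submission
  imports Defs
begin

text \<open>Items are bit strings of length \<open>q\<close>, and the tests are the \<open>4 * (q choose 2)\<close> ways of prescribing
  the bits at two positions. Call the set of defectives whose bit \<open>p\<close> is \<open>i\<close> a face. The tests
  that prescribe bit \<open>p\<close> to be \<open>i\<close> reveal the bitwise conjunction and disjunction of the face. These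
  tell whether the face has none, one or more defectives, give the defective if it is alone, and
  give the sum of the defectives if there are two, since \<open>a + b = (a AND b) + (a OR b)\<close>; for three
  they only underestimate it. Among at most three defectives, the ones isolated by a face include two
  distinct ones unless there is only one defective, and the third is the difference to the sum
  over all defectives, which is the largest value found for the two faces of a position. All numbers
  are shifted by one to distinguish the item 0 from no item. Separability follows since the program
  is deterministic.\<close>

section \<open>Loop-free programs and counting loops\<close>

abbreviation then_do :: "com \<Rightarrow> com \<Rightarrow> com" (infixr \<open>;;\<close> 60) where
  "c1 ;; c2 \<equiv> Seq c1 c2"

fun loop_free :: "com \<Rightarrow> bool" where
  "loop_free (Seq c1 c2) \<longleftrightarrow> loop_free c1 \<and> loop_free c2"
| "loop_free (com.If x c1 c2) \<longleftrightarrow> loop_free c1 \<and> loop_free c2"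
| "loop_free (While x c) \<longleftrightarrow> False"
| "loop_free _ \<longleftrightarrow> True"

text \<open>An evaluator that simplification can unfold on loop-free code. The clause for
  \<open>While\<close> is a dummy.\<close>

fun run :: "com \<Rightarrow> state \<Rightarrow> state" where
  "run (com.Const x a) (r, m) = (r(x := a), m)"
| "run (com.Add x y z) (r, m) = (r(x := r y + r z), m)"
| "run (com.Sub x y z) (r, m) = (r(x := r y - r z), m)"
| "run (Load x y) (r, m) = (r(x := m (r y)), m)"
| "run (Store x y) (r, m) = (r, m(r x := r y))"
| "run (Seq c1 c2) s = run c2 (run c1 s)"
| "run (com.If x c1 c2) (r, m) = (if r x \<noteq> 0 then run c1 (r, m) else run c2 (r, m))"
| "run (While x c) s = s"

fun cost :: "com \<Rightarrow> nat" where
  "cost (Seq c1 c2) = cost c1 + cost c2"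
| "cost (com.If x c1 c2) = Suc (max (cost c1) (cost c2))"
| "cost _ = 1"

text \<open>Total correctness with an upper bound on the steps, so that branches of different
  lengths fit one bound.\<close>

definition terminates :: "com \<Rightarrow> state \<Rightarrow> nat \<Rightarrow> (state \<Rightarrow> bool) \<Rightarrow> bool" where
  "terminates c s b Q \<longleftrightarrow> (\<exists>k s'. exec c s k s' \<and> k \<le> b \<and> Q s')"

lemma terminates_run:
  assumes "loop_free c" and "Q (run c s)"
  shows "terminates c s (cost c) Q"
proof -
  have "\<exists>k. exec c s k (run c s) \<and> k \<le> cost c"
    using assms(1)
  proof (induction c arbitrary: s)
    case (Seq c1 c2)
    from Seq.IH(1)[of s] Seq.prems obtain k1 where "exec c1 s k1 (run c1 s)" "k1 \<le> cost c1"
      by auto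
    moreover from Seq.IH(2)[of "run c1 s"] Seq.prems obtain k2
      where "exec c2 (run c1 s) k2 (run c2 (run c1 s))" "k2 \<le> cost c2"
      by auto
    ultimately show ?case
      by (auto intro!: exI[of _ "k1 + k2"] exec.Seq)
  next
    case (If x c1 c2)
    obtain r m where s: "s = (r, m)" by (cases s)
    show ?case
    proof (cases "r x = 0")
      case True
      with If.IH(2)[of s] If.prems obtain k where "exec c2 s k (run c2 s)" "k \<le> cost c2"
        by auto
      with True s show ?thesis
        by (auto intro!: exI[of _ "k + 1"] exec.IfFalse)
    next
      case False
      with If.IH(1)[of s] If.prems obtain k where "exec c1 s k (run c1 s)" "k \<le> cost c1"
        by auto
      with False s show ?thesis
        by (auto intro!: exI[of _ "k + 1"] exec.IfTrue)
    qed
  next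
    case (While x c)
    then show ?case by simp
  qed (rule exI[of _ 1], case_tac s, simp del: One_nat_def add: exec.intros)+
  with assms(2) show ?thesis
    unfolding terminates_def by blast
qed

lemma terminates_Seq:
  assumes "terminates c1 s b1 R" and "\<And>s'. R s' \<Longrightarrow> terminates c2 s' b2 Q"
  shows "terminates (c1 ;; c2) s (b1 + b2) Q"
  using assms unfolding terminates_def by (meson add_mono exec.Seq)

lemma terminates_mono:
  assumes "terminates c s b Q" and "b \<le> b'" and "\<And>s'. Q s' \<Longrightarrow> Q' s'"
  shows "terminates c s b' Q'"
  using assms unfolding terminates_def by (meson order_trans)

text \<open>The invariant is indexed by the number of completed passes. Each of the \<open>N\<close>
  passes pays one extra step for the condition, and its last, failing evaluation adds one more. The
  induction runs downward from \<open>N\<close>, on the passes that remain.\<close>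

lemma terminates_While:
  assumes body: "\<And>k s. \<lbrakk>k < N; I k s\<rbrakk> \<Longrightarrow> fst s x \<noteq> 0 \<and> terminates c s b (I (Suc k))"
    and stop: "\<And>s. I N s \<Longrightarrow> fst s x = 0"
    and init: "I 0 s"
  shows "terminates (While x c) s (N * Suc b + 1) (I N)"
proof -
  have "terminates (While x c) s ((N - k) * Suc b + 1) (I N)" if "k \<le> N" "I k s" for k s
    using that
  proof (induction k arbitrary: s rule: inc_induct)
    case base
    obtain r m where "s = (r, m)" by (cases s)
    with base stop[of s] show ?case
      unfolding terminates_def
      by (intro exI[of _ 1] exI[of _ s]) (simp del: One_nat_def add: exec.WhileFalse)
  next
    case (step k)
    obtain r m where s: "s = (r, m)" by (cases s)
    from body[OF step.hyps(2) step.prems] obtain j s'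
      where j: "fst s x \<noteq> 0" "exec c s j s'" "j \<le> b" "I (Suc k) s'"
      by (auto simp: terminates_def)
    from step.IH[OF j(4)] obtain j' s''
      where j': "exec (While x c) s' j' s''" "j' \<le> (N - Suc k) * Suc b + 1" "I N s''"
      by (auto simp: terminates_def)
    have "exec (While x c) s (j + j' + 1) s''"
      using exec.WhileTrue[of r x c m j s' j' s''] j j' s by simp
    moreover have "N - k = Suc (N - Suc k)"
      using step.hyps by simp
    then have "j + j' + 1 \<le> (N - k) * Suc b + 1"
      using j(3) j'(2) by simp
    ultimately show ?case
      using j'(3) unfolding terminates_def by blast
  qed
  from this[of 0 s] init show ?thesis by simp
qed

section \<open>The tests\<close>

text \<open>Pairs \<open>k < p\<close> are listed by increasing \<open>p\<close>, four rows per
  pair: the pairs with larger position below \<open>p\<close> fill the first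
  \<open>2 * p * (p - 1)\<close> rows. Row numbers thus do not depend on \<open>q\<close>.\<close>

definition test_row :: "nat \<Rightarrow> nat \<Rightarrow> bool \<Rightarrow> bool \<Rightarrow> nat" where
  "test_row p k i j = 2 * p * (p - 1) + 4 * k + 2 * of_bool i + of_bool j"

definition bit_pair_matrix :: "nat \<Rightarrow> bool mat" where
  "bit_pair_matrix q = mat (2 * q\<^sup>2 - 2 * q) (2 ^ q) (\<lambda>(a, x).
    \<exists>p k. k < p \<and> a = test_row p k (bit x p) (bit x k))"

text \<open>Block \<open>p\<close> of the rows has size \<open>4 * p\<close>. The machine, which
  cannot multiply, advances its row offsets in the same way.\<close>

lemma double_pronic_Suc: "2 * Suc p * (Suc p - 1) = 2 * p * (p - 1) + 4 * p"
  by (cases p) auto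

lemma double_pronic_mono: "p \<le> q \<Longrightarrow> 2 * p * (p - 1) \<le> 2 * q * (q - 1)" for p q :: nat
  by (intro mult_mono) auto

lemma test_row_less:
  assumes "k < p" and "p < q"
  shows "test_row p k i j < 2 * q * (q - 1)"
proof -
  have "test_row p k i j < 2 * Suc p * (Suc p - 1)"
    using assms(1) unfolding double_pronic_Suc test_row_def by (cases i; cases j) auto
  also have "\<dots> \<le> 2 * q * (q - 1)"
    using assms(2) by (intro double_pronic_mono) auto
  finally show ?thesis .
qed

text \<open>By \<open>test_row_less\<close> the blocks of different \<open>p\<close> are disjoint.
  Inside a block, relative to its offset, \<open>k\<close> is the quotient by 4 and the two bits
  form the remainder.\<close>

lemma test_row_inject:
  assumes "test_row p k i j = test_row p' k' i' j'" and "k < p" and "k' < p'"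
  shows "p = p' \<and> k = k' \<and> i = i' \<and> j = j'"
proof -
  have "p = p'"
  proof (rule ccontr)
    assume "p \<noteq> p'"
    then consider "p < p'" | "p' < p" by linarith
    then show False
    proof cases
      case 1
      have "test_row p k i j < 2 * p' * (p' - 1)"
        using assms(2) 1 by (rule test_row_less)
      with assms(1) show False by (simp add: test_row_def)
    next
      case 2
      have "test_row p' k' i' j' < 2 * p * (p - 1)"
        using assms(3) 2 by (rule test_row_less)
      with assms(1) show False by (simp add: test_row_def)
    qed
  qed
  with assms(1) have "4 * k + 2 * of_bool i + of_bool j = 4 * k' + 2 * of_bool i' + (of_bool j' :: nat)"
    by (simp add: test_row_def)
  then have "k = k' \<and> i = i' \<and> j = j'"
    by (cases i; cases i'; cases j; cases j'; simp; presburger)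
  with \<open>p = p'\<close> show ?thesis by simp
qed

lemma boolean_sum_test_row:
  assumes "k < p" and "p < q" and "D \<subseteq> {..<2 ^ q}"
  shows "test_row p k i j < dim_vec (boolean_sum (bit_pair_matrix q) D)"
    and "boolean_sum (bit_pair_matrix q) D $ test_row p k i j
      \<longleftrightarrow> (\<exists>d\<in>D. bit d p = i \<and> bit d k = j)"
proof -
  have dim: "test_row p k i j < 2 * q\<^sup>2 - 2 * q"
    using test_row_less[OF assms(1,2), of i j]
    by (simp add: power2_eq_square diff_mult_distrib2 mult.assoc)
  then show "test_row p k i j < dim_vec (boolean_sum (bit_pair_matrix q) D)"
    by (simp add: boolean_sum_def bit_pair_matrix_def)
  have "bit_pair_matrix q $$ (test_row p k i j, d) \<longleftrightarrow> bit d p = i \<and> bit d k = j"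
    if "d \<in> D" for d
  proof -
    from that assms(3) have "d < 2 ^ q" by auto
    with dim assms(1) show ?thesis
      unfolding bit_pair_matrix_def by (auto dest!: test_row_inject)
  qed
  with dim show "boolean_sum (bit_pair_matrix q) D $ test_row p k i j
      \<longleftrightarrow> (\<exists>d\<in>D. bit d p = i \<and> bit d k = j)"
    by (auto simp: boolean_sum_def bit_pair_matrix_def)
qed

section \<open>Reading a set of items off the tests\<close>

text \<open>Nonzero is to mean that some member of the face has bit \<open>k\<close> equal to
  \<open>j\<close>. Tests are stored with the larger position first, hence the swap. No test has
  \<open>k = p\<close>; the default there is right for a nonempty face.\<close>

definition entry :: "(nat \<Rightarrow> nat) \<Rightarrow> nat \<Rightarrow> bool \<Rightarrow> nat \<Rightarrow> bool \<Rightarrow> nat" where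
  "entry m p i k j =
    (if k < p then m (test_row p k i j)
     else if p < k then m (test_row k p j i)
     else of_bool (i = j))"

text \<open>For a nonempty face and all positions, one plus the bitwise conjunction;
  \<open>upper\<close> does the same for the disjunction. The number of positions is a parameter
  because the inner loop computes partial sums.\<close>

definition lower :: "(nat \<Rightarrow> nat) \<Rightarrow> nat \<Rightarrow> bool \<Rightarrow> nat \<Rightarrow> nat" where
  "lower m p i q = 1 + (\<Sum>k<q. 2 ^ k * of_bool (entry m p i k False = 0))"

definition upper :: "(nat \<Rightarrow> nat) \<Rightarrow> nat \<Rightarrow> bool \<Rightarrow> nat \<Rightarrow> nat" where
  "upper m p i q = 1 + (\<Sum>k<q. 2 ^ k * of_bool (entry m p i k True \<noteq> 0))"

text \<open>The cases detect, in this order, an empty face, a face with at least two members, and a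
  singleton.\<close>

definition face_sum :: "(nat \<Rightarrow> nat) \<Rightarrow> nat \<Rightarrow> nat \<Rightarrow> bool \<Rightarrow> nat" where
  "face_sum m q p i =
    (if upper m p i q < lower m p i q then 0
     else if lower m p i q < upper m p i q then lower m p i q + upper m p i q
     else lower m p i q)"

definition singles :: "(nat \<Rightarrow> nat) \<Rightarrow> nat \<Rightarrow> nat \<Rightarrow> nat set" where
  "singles m q p = {lower m l i q | l i. l < p \<and> lower m l i q = upper m l i q}"

definition total :: "(nat \<Rightarrow> nat) \<Rightarrow> nat \<Rightarrow> nat \<Rightarrow> nat" where
  "total m q p = face_sum m q p False + face_sum m q p True"

definition represents :: "nat \<Rightarrow> (nat \<Rightarrow> nat) \<Rightarrow> nat set \<Rightarrow> bool" where
  "represents q m D \<longleftrightarrow> (\<forall>p<q. \<forall>k<p. \<forall>i j.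
    m (test_row p k i j) \<noteq> 0 \<longleftrightarrow> (\<exists>d\<in>D. bit d p = i \<and> bit d k = j))"

definition face :: "nat set \<Rightarrow> nat \<Rightarrow> bool \<Rightarrow> nat set" where
  "face D p i = {d \<in> D. bit d p = i}"

section \<open>Binary expansions of items\<close>

lemma nat_eq_bit_sum:
  fixes d :: nat
  assumes "d < 2 ^ q"
  shows "d = (\<Sum>k<q. 2 ^ k * of_bool (bit d k))"
proof -
  have "d = take_bit q d"
    using assms by (simp add: take_bit_nat_eq_self)
  also have "\<dots> = (\<Sum>k<q. 2 ^ k * of_bool (bit d k))"
    by (simp add: take_bit_sum push_bit_eq_mult atLeast0LessThan mult.commute)
  finally show ?thesis .
qed

lemma bit_differs:
  fixes a b :: nat
  assumes "a < 2 ^ q" and "b < 2 ^ q" and "a \<noteq> b"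
  shows "\<exists>k<q. bit a k \<noteq> bit b k"
proof (rule ccontr)
  assume "\<not> ?thesis"
  then have "(\<Sum>k<q. 2 ^ k * of_bool (bit a k)) = (\<Sum>k<q. 2 ^ k * (of_bool (bit b k) :: nat))"
    by (intro sum.cong) auto
  with nat_eq_bit_sum[OF assms(1)] nat_eq_bit_sum[OF assms(2)] assms(3) show False by simp
qed

lemma singles_Suc:
  "singles m q (Suc p) = singles m q p \<union>
    (\<Union>i\<in>{False, True}. if lower m p i q = upper m p i q then {lower m p i q} else {})"
  by (auto simp: singles_def less_Suc_eq split: if_splits) (metis (full_types))+

lemma finite_singles: "finite (singles m q p)"
  by (induction p) (simp_all add: singles_Suc, simp add: singles_def)

section \<open>Recognising empty, singleton and larger faces\<close>

locale tested =
  fixes q :: nat and m :: "nat \<Rightarrow> nat" and D :: "nat set"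
  assumes q: "2 \<le> q" and D: "D \<subseteq> {..<2 ^ q}" and card_D: "card D \<le> 3"
    and rep: "represents q m D"
begin

lemma finite_D: "finite D"
  using D by (rule finite_subset) simp

lemma entry_face:
  assumes "p < q" and "k < q" and "face D p i \<noteq> {} \<or> p \<noteq> k"
  shows "entry m p i k j \<noteq> 0 \<longleftrightarrow> (\<exists>d\<in>face D p i. bit d k = j)"
proof -
  consider "k < p" | "p < k" | "p = k" by linarith
  then show ?thesis
  proof cases
    case 1
    then show ?thesis
      using rep assms unfolding represents_def entry_def face_def by simp blast
  next
    case 2
    then show ?thesis
      using rep assms unfolding represents_def entry_def face_def by simp blast
  next
    case 3
    then show ?thesis
      using assms by (auto simp: entry_def face_def)
  qed
qed

lemma lower_face:
  assumes "p < q" and "face D p i \<noteq> {}"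
  shows "lower m p i q = 1 + (\<Sum>k<q. 2 ^ k * of_bool (\<forall>d\<in>face D p i. bit d k))"
proof -
  have "entry m p i k False = 0 \<longleftrightarrow> (\<forall>d\<in>face D p i. bit d k)" if "k < q" for k
    using entry_face[OF assms(1) that, of i False] assms(2) by auto
  then show ?thesis
    unfolding lower_def by simp
qed

lemma upper_face:
  assumes "p < q" and "face D p i \<noteq> {}"
  shows "upper m p i q = 1 + (\<Sum>k<q. 2 ^ k * of_bool (\<exists>d\<in>face D p i. bit d k))"
proof -
  have "entry m p i k True \<noteq> 0 \<longleftrightarrow> (\<exists>d\<in>face D p i. bit d k)" if "k < q" for k
    using entry_face[OF assms(1) that, of i True] assms(2) by auto
  then show ?thesis
    unfolding upper_def by simp
qed

text \<open>All tests of the face are negative, so away from \<open>p\<close> the conjunction gets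
  every bit and the disjunction none, while the default entries at \<open>p\<close> give both the
  same bit. Strictness needs a position other than \<open>p\<close>, which \<open>2 \<le> q\<close>
  provides.\<close>

lemma face_empty:
  assumes "p < q" and "face D p i = {}"
  shows "upper m p i q < lower m p i q"
proof -
  have "\<exists>k<q. k \<noteq> p"
    using q by (intro exI[of _ "if p = 0 then 1 else 0"]) auto
  then obtain l where l: "l < q" "l \<noteq> p" by blast
  have off: "entry m p i k j = 0" if "k < q" "k \<noteq> p" for k j
    using entry_face[OF assms(1) that(1), of i j] that(2) assms(2) by auto
  have "(\<Sum>k<q. 2 ^ k * of_bool (entry m p i k True \<noteq> 0))
      < (\<Sum>k<q. 2 ^ k * (of_bool (entry m p i k False = 0) :: nat))"
  proof (rule sum_strict_mono_ex1)
    show "\<forall>k\<in>{..<q}. 2 ^ k * of_bool (entry m p i k True \<noteq> 0)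
        \<le> 2 ^ k * (of_bool (entry m p i k False = 0) :: nat)"
    proof
      fix k assume "k \<in> {..<q}"
      with off show "2 ^ k * of_bool (entry m p i k True \<noteq> 0)
          \<le> 2 ^ k * (of_bool (entry m p i k False = 0) :: nat)"
        by (cases "k = p") (auto simp: entry_def)
    qed
    show "\<exists>k\<in>{..<q}. 2 ^ k * of_bool (entry m p i k True \<noteq> 0)
        < 2 ^ k * (of_bool (entry m p i k False = 0) :: nat)"
      using l off by (intro bexI[of _ l]) auto
  qed simp
  then show ?thesis
    by (simp add: lower_def upper_def)
qed

lemma face_single:
  assumes "p < q" and "face D p i = {d}"
  shows "lower m p i q = Suc d" and "upper m p i q = Suc d"
proof -
  have "d < 2 ^ q"
    using assms(2) D by (auto simp: face_def)
  then show "lower m p i q = Suc d" "upper m p i q = Suc d"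
    using nat_eq_bit_sum[of d q] by (simp_all add: lower_face upper_face assms)
qed

text \<open>Two members differ at some bit; there the conjunction has 0 and the disjunction has
  1.\<close>

lemma face_two:
  assumes "p < q" and "a \<in> face D p i" and "b \<in> face D p i" and "a \<noteq> b"
  shows "lower m p i q < upper m p i q"
proof -
  have "a < 2 ^ q" "b < 2 ^ q"
    using assms D by (auto simp: face_def)
  from bit_differs[OF this assms(4)] obtain l where l: "l < q" "bit a l \<noteq> bit b l"
    by blast
  have "(\<Sum>k<q. 2 ^ k * of_bool (\<forall>d\<in>face D p i. bit d k))
      < (\<Sum>k<q. 2 ^ k * (of_bool (\<exists>d\<in>face D p i. bit d k) :: nat))"
  proof (rule sum_strict_mono_ex1)
    show "\<exists>k\<in>{..<q}. 2 ^ k * of_bool (\<forall>d\<in>face D p i. bit d k)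
        < 2 ^ k * (of_bool (\<exists>d\<in>face D p i. bit d k) :: nat)"
      using l assms(2,3) by (intro bexI[of _ l]) auto
  qed (use assms(2) in auto)
  moreover have "face D p i \<noteq> {}" using assms(2) by auto
  ultimately show ?thesis
    by (simp add: lower_face upper_face assms(1))
qed

lemma lower_eq_upper_iff:
  assumes "p < q"
  shows "lower m p i q = upper m p i q \<longleftrightarrow> (\<exists>d. face D p i = {d})"
proof
  assume eq: "lower m p i q = upper m p i q"
  have "face D p i \<noteq> {}"
    using face_empty[OF assms, of i] eq by auto
  then obtain a where "a \<in> face D p i" by blast
  then have "face D p i = {a}"
    using face_two[OF assms, of a i] eq by fastforce
  then show "\<exists>d. face D p i = {d}" ..
next
  assume "\<exists>d. face D p i = {d}"
  then show "lower m p i q = upper m p i q"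
    using face_single[OF assms] by auto
qed

lemma singles_eq: "singles m q q = Suc ` {d. \<exists>p<q. \<exists>i. face D p i = {d}}"
proof (intro equalityI subsetI)
  fix v assume "v \<in> singles m q q"
  then obtain p i where p: "p < q" "v = lower m p i q" "lower m p i q = upper m p i q"
    by (auto simp: singles_def)
  from p lower_eq_upper_iff[OF p(1), of i] obtain d where "face D p i = {d}"
    by auto
  with face_single[OF p(1) this] p show "v \<in> Suc ` {d. \<exists>p<q. \<exists>i. face D p i = {d}}"
    by auto
next
  fix v assume "v \<in> Suc ` {d. \<exists>p<q. \<exists>i. face D p i = {d}}"
  then obtain d p i where p: "v = Suc d" "p < q" "face D p i = {d}" by auto
  with face_single[OF p(2,3)] show "v \<in> singles m q q"
    by (auto simp: singles_def intro!: exI[of _ p] exI[of _ i])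
qed

section \<open>The sum over all defectives\<close>

lemma card_face: "card (face D p i) \<le> 3"
proof -
  have "card (face D p i) \<le> card D"
    by (intro card_mono finite_D) (auto simp: face_def)
  with card_D show ?thesis by simp
qed

text \<open>Counting ones per bit allows sums to be compared one binary position at a time; the
  cardinality accounts for the shifts by one.\<close>

lemma sum_Suc_face:
  "sum Suc (face D p i) = card (face D p i) + (\<Sum>k<q. 2 ^ k * (\<Sum>d\<in>face D p i. of_bool (bit d k)))"
proof -
  have "sum Suc (face D p i) = card (face D p i) + (\<Sum>d\<in>face D p i. d)"
    by (simp add: sum_Suc)
  also have "(\<Sum>d\<in>face D p i. d) = (\<Sum>d\<in>face D p i. \<Sum>k<q. 2 ^ k * of_bool (bit d k))"
    using D by (intro sum.cong refl nat_eq_bit_sum) (auto simp: face_def)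
  also have "\<dots> = (\<Sum>k<q. 2 ^ k * (\<Sum>d\<in>face D p i. of_bool (bit d k)))"
    by (subst sum.swap) (simp add: sum_distrib_left)
  finally show ?thesis .
qed

text \<open>Two numbers have the same sum as their bitwise conjunction and disjunction.\<close>

lemma face_sum_eq:
  assumes "p < q" and "card (face D p i) \<le> 2"
  shows "face_sum m q p i = sum Suc (face D p i)"
proof -
  have "finite (face D p i)" using finite_D by (simp add: face_def)
  consider "face D p i = {}" | d where "face D p i = {d}"
    | a b where "face D p i = {a, b}" "a \<noteq> b"
  proof -
    have "card (face D p i) = 0 \<or> card (face D p i) = 1 \<or> card (face D p i) = 2"
      using assms(2) by linarith
    with that \<open>finite (face D p i)\<close> show thesis
      by (auto simp: card_1_singleton_iff card_2_iff)
  qed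
  then show ?thesis
  proof cases
    case 1
    with face_empty[OF assms(1), of i] show ?thesis by (simp add: face_sum_def)
  next
    case (2 d)
    with face_single[OF assms(1) this] show ?thesis by (simp add: face_sum_def)
  next
    case (3 a b)
    have "lower m p i q < upper m p i q"
      using face_two[OF assms(1), of a i b] 3 by simp
    then have "face_sum m q p i = lower m p i q + upper m p i q"
      by (simp add: face_sum_def)
    \<comment> \<open>The 2 collects the shifts in \<open>lower\<close> and \<open>upper\<close>; it
      is also the cardinality of the face.\<close>
    also have "\<dots> = 2 + (\<Sum>k<q. 2 ^ k * (of_bool (bit a k \<and> bit b k) + of_bool (bit a k \<or> bit b k)))"
      using 3 assms(1) by (simp add: lower_face upper_face sum.distrib distrib_left)
    also have "\<dots> = 2 + (\<Sum>k<q. 2 ^ k * (\<Sum>d\<in>face D p i. of_bool (bit d k)))"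
      using 3 by (intro arg_cong2[of _ _ _ _ "(+)"] sum.cong refl) auto
    also have "\<dots> = sum Suc (face D p i)"
      using 3 unfolding sum_Suc_face by simp
    finally show ?thesis .
  qed
qed

text \<open>A bit set in 0, 1, 2, 3 of three members is counted 0, 1, 1, 2 times by conjunction and
  disjunction together, so never too often, and the shifts contribute 2 instead of 3.\<close>

lemma face_sum_le:
  assumes "p < q"
  shows "face_sum m q p i \<le> sum Suc (face D p i)"
proof (cases "card (face D p i) \<le> 2")
  case True
  then show ?thesis using face_sum_eq[OF assms] by simp
next
  case False
  then have "card (face D p i) = 3" using card_face[of p i] by linarith
  then obtain a b c where abc: "face D p i = {a, b, c}" "a \<noteq> b" "b \<noteq> c" "a \<noteq> c"
    by (auto simp: card_3_iff)
  have "lower m p i q < upper m p i q"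
    using face_two[OF assms, of a i b] abc by simp
  then have "face_sum m q p i = lower m p i q + upper m p i q"
    by (simp add: face_sum_def)
  also have "\<dots> = 2 + (\<Sum>k<q. 2 ^ k * (of_bool (bit a k \<and> bit b k \<and> bit c k)
      + of_bool (bit a k \<or> bit b k \<or> bit c k)))"
    using abc assms by (simp add: lower_face upper_face sum.distrib distrib_left)
  also have "\<dots> \<le> 3 + (\<Sum>k<q. 2 ^ k * (\<Sum>d\<in>face D p i. of_bool (bit d k)))"
    using abc by (intro add_mono sum_mono mult_left_mono) auto
  also have "\<dots> = sum Suc (face D p i)"
    using abc unfolding sum_Suc_face by simp
  finally show ?thesis .
qed

lemma sum_faces: "sum Suc (face D p False) + sum Suc (face D p True) = sum Suc D"
proof -
  have "D = face D p False \<union> face D p True"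
    by (auto simp: face_def)
  moreover have "sum Suc (face D p False \<union> face D p True)
      = sum Suc (face D p False) + sum Suc (face D p True)"
    by (rule sum.union_disjoint) (use finite_D in \<open>auto simp: face_def\<close>)
  ultimately show ?thesis by simp
qed

lemma total_le: "p < q \<Longrightarrow> total m q p \<le> sum Suc D"
  unfolding total_def sum_faces[of p, symmetric] by (intro add_mono face_sum_le)

lemma total_eq:
  assumes "p < q" and "\<And>i. card (face D p i) \<le> 2"
  shows "total m q p = sum Suc D"
  unfolding total_def sum_faces[of p, symmetric] using assms by (simp add: face_sum_eq)

text \<open>Each face at a position where two defectives differ misses one of them.\<close>

lemma card_face_pivot:
  assumes "a \<in> D" and "b \<in> D" and "bit a p \<noteq> bit b p"
  shows "card (face D p i) \<le> 2"
proof -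
  have "face D p i \<subset> D"
    using assms by (auto simp: face_def)
  then have "card (face D p i) < card D"
    by (intro psubset_card_mono finite_D)
  with card_D show ?thesis by simp
qed

text \<open>No position gives too large a total, and some position gives the exact one: any position
  if there are at most two defectives, otherwise one that splits the three.\<close>

lemma Max_total: "Max (insert 0 (total m q ` {..<q})) = sum Suc D"
proof (rule Max_eqI)
  show "sum Suc D \<in> insert 0 (total m q ` {..<q})"
  proof (cases "card D \<le> 2")
    case True
    have "card (face D 0 i) \<le> card D" for i
      by (intro card_mono finite_D) (auto simp: face_def)
    with True have "card (face D 0 i) \<le> 2" for i
      using order_trans by blast
    with q have "total m q 0 = sum Suc D"
      by (intro total_eq) auto
    with q show ?thesis by (intro insertI2 image_eqI[of _ _ 0]) auto
  next
    case False
    with card_D have "card D = 3" by linarith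
    then obtain a b c where abc: "D = {a, b, c}" "a \<noteq> b" by (auto simp: card_3_iff)
    with D bit_differs[of a q b] obtain p where p: "p < q" "bit a p \<noteq> bit b p" by auto
    then have "total m q p = sum Suc D"
      using abc by (intro total_eq card_face_pivot[of a b]) auto
    with p show ?thesis by force
  qed
qed (auto simp: total_le)

section \<open>Defectives isolated by a face\<close>

lemma singles_subset: "singles m q q \<subseteq> Suc ` D"
  unfolding singles_eq by (auto simp: face_def)

text \<open>Otherwise \<open>a\<close> and \<open>b\<close> each share their face with a further
  defective; as the two faces are disjoint, this makes four defectives.\<close>

lemma pivot_single:
  assumes "a \<in> D" and "b \<in> D" and "bit a p \<noteq> bit b p"
  shows "face D p (bit a p) = {a} \<or> face D p (bit b p) = {b}"
proof (rule ccontr)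
  assume "\<not> ?thesis"
  moreover have "a \<in> face D p (bit a p)" "b \<in> face D p (bit b p)"
    using assms by (auto simp: face_def)
  ultimately obtain a' b' where "a' \<in> face D p (bit a p)" "a' \<noteq> a"
    "b' \<in> face D p (bit b p)" "b' \<noteq> b"
    by blast
  with assms have "{a, a', b, b'} \<subseteq> D" "card {a, a', b, b'} = 4"
    by (auto simp: face_def card_insert_if)
  then have "4 \<le> card D"
    by (metis card_mono finite_D)
  with card_D show False by simp
qed

text \<open>Apply \<open>pivot_single\<close> at a bit where the two differ. Hence at most one
  defective is isolated by no face.\<close>

lemma single_other:
  assumes "a \<in> D" and "b \<in> D" and "a \<noteq> b"
  shows "Suc a \<in> singles m q q \<or> Suc b \<in> singles m q q"
proof -
  have "a < 2 ^ q" "b < 2 ^ q" using assms D by auto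
  from bit_differs[OF this assms(3)] obtain p where "p < q" "bit a p \<noteq> bit b p" by blast
  with pivot_single[OF assms(1,2)] show ?thesis
    unfolding singles_eq by blast
qed

text \<open>The inserted \<open>2 ^ q\<close> and \<open>0\<close> are the initial register values.
  Shifted items lie between 1 and \<open>2 ^ q\<close>, so these values do not change the extrema of
  a nonempty set of singles.\<close>

lemma Min_Max_singles:
  assumes "D \<noteq> {}"
  defines "x \<equiv> Min (insert (2 ^ q) (singles m q q))"
    and "y \<equiv> Max (insert 0 (singles m q q))"
  shows "x \<in> Suc ` D" and "y \<in> Suc ` D" and "1 < card D \<Longrightarrow> x < y"
proof -
  have le: "v \<le> 2 ^ q" if "v \<in> singles m q q" for v
    using that singles_subset D by (fastforce simp: Suc_le_eq)
  have ne: "singles m q q \<noteq> {}"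
  proof (cases "card D = 1")
    case True
    then obtain d where "D = {d}" by (auto simp: card_1_singleton_iff)
    then have "face D 0 (bit d 0) = {d}" by (auto simp: face_def)
    moreover have "0 < q" using q by simp
    ultimately show ?thesis unfolding singles_eq by blast
  next
    case False
    from assms(1) obtain a where "a \<in> D" by blast
    with False have "D \<noteq> {a}" by auto
    with \<open>a \<in> D\<close> obtain b where "b \<in> D" "a \<noteq> b" by blast
    with single_other \<open>a \<in> D\<close> show ?thesis by blast
  qed
  have "x = min (2 ^ q) (Min (singles m q q))"
    unfolding x_def using ne finite_singles by simp
  also have "\<dots> = Min (singles m q q)"
    using ne le finite_singles by (intro min_absorb2) auto
  finally have x: "x = Min (singles m q q)" .
  have y: "y = Max (singles m q q)"
    unfolding y_def using ne finite_singles by simp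
  show "x \<in> Suc ` D" "y \<in> Suc ` D"
    using x y ne finite_singles singles_subset by (meson Min_in Max_in subsetD)+
  assume "1 < card D"
  show "x < y"
  proof (rule ccontr)
    assume "\<not> x < y"
    then have single: "v = x" if "v \<in> singles m q q" for v
      using that x y finite_singles by (meson Min_le Max_ge le_antisym le_less_trans not_less)
    obtain c where c: "x = Suc c" "c \<in> D" using \<open>x \<in> Suc ` D\<close> by blast
    show False
    \<comment> \<open>Suppose \<open>c\<close> gives the only single. Two further defectives
      contradict \<open>single_other\<close>; if there is just one, a bit separating it from
      \<open>c\<close> isolates it as well.\<close>
    proof (cases "\<exists>a b. a \<in> D - {c} \<and> b \<in> D - {c} \<and> a \<noteq> b")
      case True
      then show False using single_other single c by blast
    next
      case False
      have "D \<noteq> {c}" using \<open>1 < card D\<close> by auto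
      with c obtain b where b: "b \<in> D" "b \<noteq> c" by blast
      with False have Dbc: "D = {b, c}" using c by blast
      have "b < 2 ^ q" "c < 2 ^ q" using b c D by auto
      from bit_differs[OF this b(2)] obtain p where p: "p < q" "bit b p \<noteq> bit c p" by blast
      with Dbc have "face D p (bit b p) = {b}" by (auto simp: face_def)
      with p have "Suc b \<in> singles m q q" unfolding singles_eq by blast
      with single b c show False by blast
    qed
  qed
qed

end

section \<open>The program\<close>

text \<open>Register 0 holds \<open>n = 2 ^ q\<close>. In the outer loop over \<open>p\<close>, registers 2, 4, 5 hold \<open>2 ^ p\<close>,
  \<open>2 * p * (p - 1)\<close>, \<open>4 * p\<close>; in the inner loop over \<open>k\<close>, registers 3, 6, 7 hold the same
  expressions in \<open>k\<close>. Registers 8 and 9 hold \<open>lower\<close> and \<open>upper\<close>, registers 13 and 14 the loop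
  conditions, registers 15 and 16 the least and the greatest single found so far, register 17 the
  greatest total, and register 18 the current one.\<close>

definition face_step :: "bool \<Rightarrow> com" where
  "face_step i =
    com.Sub 12 2 3 ;;
    com.If 12
      (com.Add 12 4 7 ;; com.Const 10 (2 * of_bool i) ;; com.Add 12 12 10 ;; Load 10 12 ;;
       com.Const 11 1 ;; com.Add 12 12 11 ;; Load 11 12)
      (com.Sub 12 3 2 ;;
       com.If 12
         (com.Add 12 6 5 ;; com.Const 10 (of_bool i) ;; com.Add 12 12 10 ;; Load 10 12 ;;
          com.Const 11 2 ;; com.Add 12 12 11 ;; Load 11 12)
         (com.Const 10 (of_bool (\<not> i)) ;; com.Const 11 (of_bool i))) ;;
    com.If 10 (com.Const 12 0) (com.Add 8 8 3) ;;
    com.If 11 (com.Add 9 9 3) (com.Const 12 0) ;;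
    com.Add 6 6 7 ;; com.Const 12 4 ;; com.Add 7 7 12 ;; com.Add 3 3 3 ;; com.Sub 13 0 3"

definition face_init :: com where
  "face_init =
    com.Const 3 1 ;; com.Const 6 0 ;; com.Const 7 0 ;; com.Const 8 1 ;; com.Const 9 1 ;;
    com.Sub 13 0 3"

text \<open>Truncated subtraction yields both extrema: \<open>u + (v - u)\<close> is the maximum and
  \<open>u - (u - v)\<close> the minimum. \<open>Const 12 0\<close> serves as a no-op.\<close>

definition face_post :: com where
  "face_post =
    com.Sub 12 8 9 ;;
    com.If 12 (com.Const 12 0)
      (com.Sub 12 9 8 ;;
       com.If 12 (com.Add 18 18 8 ;; com.Add 18 18 9)
         (com.Add 18 18 8 ;; com.Sub 12 8 16 ;; com.Add 16 16 12 ;;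
          com.Sub 12 15 8 ;; com.Sub 15 15 12))"

definition face_com :: "bool \<Rightarrow> com" where
  "face_com i = face_init ;; While 13 (face_step i) ;; face_post"

definition position_post :: com where
  "position_post =
    com.Sub 12 18 17 ;; com.Add 17 17 12 ;;
    com.Add 4 4 5 ;; com.Const 12 4 ;; com.Add 5 5 12 ;; com.Add 2 2 2 ;; com.Sub 14 0 2"

definition position_com :: com where
  "position_com = com.Const 18 0 ;; face_com False ;; face_com True ;; position_post"

definition start_com :: com where
  "start_com =
    com.Const 2 1 ;; com.Const 4 0 ;; com.Const 5 0 ;; com.Const 16 0 ;; com.Const 17 0 ;;
    com.Add 15 0 16 ;; com.Sub 14 0 2"

text \<open>Let \<open>x\<close> and \<open>y\<close> be the least and greatest single and
  \<open>S\<close> the sum. Then \<open>y = 0\<close> means no defective, \<open>x = y\<close> one,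
  and \<open>S - (x + y) = 0\<close> two, since a third adds at least 1. Subtracting 1 undoes the
  shift.\<close>

definition output_com :: com where
  "output_com =
    com.Const 0 0 ;; com.Const 1 1 ;; com.Const 2 2 ;;
    com.If 16
      (com.Sub 3 16 1 ;; Store 0 3 ;; com.Sub 4 16 15 ;; com.Add 5 15 16 ;; com.Sub 6 17 5 ;;
       com.If 4
        (com.Sub 3 15 1 ;; Store 1 3 ;;
         com.If 6
           (com.Sub 3 6 1 ;; Store 2 3 ;; com.Const 0 3)
           (com.Const 0 2))
        (com.Const 0 1))
      (com.Const 0 0)"

definition decode :: com where
  "decode = start_com ;; While 14 position_com ;; output_com"

section \<open>Loop invariants and their preservation\<close>

definition position_inv :: "nat \<Rightarrow> nat \<Rightarrow> (nat \<Rightarrow> nat) \<Rightarrow> bool" where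
  "position_inv q p r \<longleftrightarrow>
    r 0 = 2 ^ q \<and> r 2 = 2 ^ p \<and> r 4 = 2 * p * (p - 1) \<and> r 5 = 4 * p \<and> r 14 = 2 ^ q - 2 ^ p"

definition face_inv ::
  "nat \<Rightarrow> nat \<Rightarrow> bool \<Rightarrow> (nat \<Rightarrow> nat) \<Rightarrow> (nat \<Rightarrow> nat) \<Rightarrow> nat \<Rightarrow> state \<Rightarrow> bool" where
  "face_inv q p i r m k s \<longleftrightarrow> (case s of (r', m') \<Rightarrow>
    m' = m \<and> position_inv q p r' \<and>
    r' 3 = 2 ^ k \<and> r' 6 = 2 * k * (k - 1) \<and> r' 7 = 4 * k \<and> r' 13 = 2 ^ q - 2 ^ k \<and>
    r' 8 = lower m p i k \<and> r' 9 = upper m p i k \<and> (\<forall>x\<in>{15, 16, 17, 18}. r' x = r x))"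

text \<open>Comparing \<open>2 ^ p\<close> with \<open>2 ^ k\<close> makes the branches of
  \<open>face_step\<close> follow the cases of \<open>entry\<close>; the entries for
  \<open>False\<close> and \<open>True\<close> end up in registers 10 and 11.\<close>

lemma face_step_inv:
  assumes "face_inv q p i r m k s"
  shows "face_inv q p i r m (Suc k) (run (face_step i) s)"
proof -
  obtain r' m' where s: "s = (r', m')" by (cases s)
  have low: "lower m p i (Suc k) = lower m p i k + (if entry m p i k False = 0 then 2 ^ k else 0)"
    and upp: "upper m p i (Suc k) = upper m p i k + (if entry m p i k True = 0 then 0 else 2 ^ k)"
    by (simp_all add: lower_def upper_def)
  have inv: "m' = m" "r' 0 = 2 ^ q" "r' 2 = 2 ^ p" "r' 4 = 2 * p * (p - 1)" "r' 5 = 4 * p"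
    "r' 14 = 2 ^ q - 2 ^ p" "r' 3 = 2 ^ k" "r' 6 = 2 * k * (k - 1)" "r' 7 = 4 * k"
    "r' 8 = lower m p i k" "r' 9 = upper m p i k" "r' 15 = r 15" "r' 16 = r 16" "r' 17 = r 17"
    "r' 18 = r 18"
    using assms by (auto simp: face_inv_def position_inv_def s)
  have pr: "2 * Suc k * (Suc k - 1) = 2 * k * (k - 1) + 4 * k" "2 ^ Suc k = 2 ^ k + (2 ^ k :: nat)"
    by (rule double_pronic_Suc) simp
  consider (less) "k < p" | (greater) "p < k" | (equal) "p = k" by linarith
  then show ?thesis
  proof cases
    case less
    then have "(2::nat) ^ k < 2 ^ p" by simp
    moreover have "entry m p i k j = m (2 * p * (p - 1) + 4 * k + 2 * of_bool i + of_bool j)" for j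
      using less by (simp add: entry_def test_row_def)
    ultimately show ?thesis
      unfolding face_step_def face_inv_def position_inv_def s low upp pr
      by (simp add: inv)
  next
    case greater
    then have "(2::nat) ^ p < 2 ^ k" by simp
    \<comment> \<open>Now \<open>k\<close> is the larger position, so in the row number
      \<open>j\<close> has weight 2 and \<open>i\<close> weight 1.\<close>
    moreover have "entry m p i k j = m (2 * k * (k - 1) + 4 * p + of_bool i + 2 * of_bool j)" for j
      using greater by (simp add: entry_def test_row_def add_ac)
    ultimately show ?thesis
      unfolding face_step_def face_inv_def position_inv_def s low upp pr
      by (simp add: inv)
  next
    case equal
    then show ?thesis
      unfolding face_step_def face_inv_def position_inv_def s low upp pr
      by (cases i) (simp_all add: inv entry_def)
  qed
qed

definition face_effect ::
  "nat \<Rightarrow> nat \<Rightarrow> bool \<Rightarrow> (nat \<Rightarrow> nat) \<Rightarrow> (nat \<Rightarrow> nat) \<Rightarrow> (nat \<Rightarrow> nat) \<Rightarrow> bool" where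
  "face_effect q p i m r r' \<longleftrightarrow> position_inv q p r' \<and>
    r' 15 = (if lower m p i q = upper m p i q then min (r 15) (lower m p i q) else r 15) \<and>
    r' 16 = (if lower m p i q = upper m p i q then max (r 16) (lower m p i q) else r 16) \<and>
    r' 17 = r 17 \<and> r' 18 = r 18 + face_sum m q p i"

lemma terminates_face:
  assumes "position_inv q p r"
  shows "terminates (face_com i) (r, m) (50 * q + 50) (\<lambda>(r', m'). m' = m \<and> face_effect q p i m r r')"
proof -
  have init: "terminates face_init (r, m) (cost face_init) (face_inv q p i r m 0)"
    by (rule terminates_run)
      (use assms in \<open>auto simp: face_init_def face_inv_def position_inv_def lower_def upper_def\<close>)
  have loop: "terminates (While 13 (face_step i)) s (q * Suc (cost (face_step i)) + 1)
      (face_inv q p i r m q)" if "face_inv q p i r m 0 s" for s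
  proof (rule terminates_While[where I = "face_inv q p i r m", OF _ _ that])
    fix k s assume k: "k < q" "face_inv q p i r m k s"
    \<comment> \<open>The condition is \<open>2 ^ q - 2 ^ k\<close>: the program is given
      \<open>2 ^ q\<close> rather than \<open>q\<close>, so it counts passes by doubling a power
      until it reaches register 0.\<close>
    have "fst s 13 \<noteq> 0"
      using k by (auto simp: face_inv_def)
    moreover have "loop_free (face_step i)" by (simp add: face_step_def)
    ultimately show "fst s 13 \<noteq> 0 \<and>
        terminates (face_step i) s (cost (face_step i)) (face_inv q p i r m (Suc k))"
      using terminates_run face_step_inv[OF k(2)] by blast
  qed (auto simp: face_inv_def)
  have post: "terminates face_post s (cost face_post) (\<lambda>(r', m'). m' = m \<and> face_effect q p i m r r')"
    if "face_inv q p i r m q s" for s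
  proof (rule terminates_run)
    show "case run face_post s of (r', m') \<Rightarrow> m' = m \<and> face_effect q p i m r r'"
      using that
      by (cases s) (auto simp: face_post_def face_inv_def face_effect_def position_inv_def face_sum_def)
  qed (simp add: face_post_def)
  have "terminates (face_com i) (r, m)
      (cost face_init + ((q * Suc (cost (face_step i)) + 1) + cost face_post))
      (\<lambda>(r', m'). m' = m \<and> face_effect q p i m r r')"
    unfolding face_com_def
    by (intro terminates_Seq[OF init] terminates_Seq[OF loop] post)
  \<comment> \<open>Unfolding the programs computes \<open>cost\<close>; both constants 50 are
    generous.\<close>
  then show ?thesis
    by (rule terminates_mono) (auto simp: face_init_def face_step_def face_post_def)
qed

definition main_inv :: "nat \<Rightarrow> (nat \<Rightarrow> nat) \<Rightarrow> nat \<Rightarrow> state \<Rightarrow> bool" where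
  "main_inv q m p s \<longleftrightarrow> (case s of (r, m') \<Rightarrow>
    m' = m \<and> position_inv q p r \<and>
    r 15 = Min (insert (2 ^ q) (singles m q p)) \<and>
    r 16 = Max (insert 0 (singles m q p)) \<and>
    r 17 = Max (insert 0 (total m q ` {..<p})))"

lemma terminates_position:
  assumes "main_inv q m p s"
  shows "terminates position_com s (100 * q + 120) (main_inv q m (Suc p))"
proof -
  obtain r where s: "s = (r, m)" and pos: "position_inv q p r"
    and r: "r 15 = Min (insert (2 ^ q) (singles m q p))" "r 16 = Max (insert 0 (singles m q p))"
      "r 17 = Max (insert 0 (total m q ` {..<p}))"
    using assms by (cases s) (auto simp: main_inv_def)
  let ?r = "r(18 := 0)"
  let ?Q1 = "\<lambda>(r', m'). m' = m \<and> face_effect q p False m ?r r'"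
  \<comment> \<open>\<open>face_effect\<close> is relative to the registers before the face, so the
    state between the two faces is kept under an existential.\<close>
  let ?Q2 = "\<lambda>(r', m'). m' = m \<and> (\<exists>r1. face_effect q p False m ?r r1 \<and> face_effect q p True m r1 r')"
  have pos': "position_inv q p ?r" using pos by (simp add: position_inv_def)
  have t0: "terminates (com.Const 18 0) s (cost (com.Const 18 0)) (\<lambda>s'. s' = (?r, m))"
    by (rule terminates_run) (simp_all add: s)
  have t1: "terminates (face_com False) s' (50 * q + 50) ?Q1" if "s' = (?r, m)" for s'
    using terminates_face[OF pos'] that by simp
  have t2: "terminates (face_com True) s' (50 * q + 50) ?Q2" if "?Q1 s'" for s'
  proof -
    obtain r1 where "s' = (r1, snd s')" by (metis prod.collapse)
    with that have r1: "s' = (r1, m)" "face_effect q p False m ?r r1"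
      by (auto split: prod.splits)
    then have "position_inv q p r1" by (simp add: face_effect_def)
    from terminates_face[OF this, of True m] show ?thesis
      unfolding r1(1) by (rule terminates_mono) (use r1 in auto)
  qed
  have t3: "terminates position_post s' (cost position_post) (main_inv q m (Suc p))"
    if "?Q2 s'" for s'
  proof (rule terminates_run)
    obtain r2 where "s' = (r2, snd s')" by (metis prod.collapse)
    with that obtain r1 where s': "s' = (r2, m)" and e1: "face_effect q p False m ?r r1"
      and e2: "face_effect q p True m r1 r2"
      by (auto split: prod.splits)
    have pos2: "position_inv q p r2" using e2 by (simp add: face_effect_def)
    have r2_15: "r2 15 = Min (insert (2 ^ q) (singles m q (Suc p)))"
      using e1 e2 r(1) finite_singles[of m q p]
      by (auto simp: face_effect_def singles_Suc insert_commute[of "2 ^ q"] min.commute min.left_commute)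
    have r2_16: "r2 16 = Max (insert 0 (singles m q (Suc p)))"
      using e1 e2 r(2) finite_singles[of m q p]
      by (auto simp: face_effect_def singles_Suc insert_commute[of "0"] max.commute max.left_commute)
    \<comment> \<open>Register 17 becomes the maximum of itself and the current total in register
      18.\<close>
    have r2_17: "r2 17 + (r2 18 - r2 17) = Max (insert 0 (total m q ` {..<Suc p}))"
      using e1 e2 r(3)
      by (auto simp: face_effect_def total_def lessThan_Suc insert_commute[of "0"] max_def)
    show "main_inv q m (Suc p) (run position_post s')"
      using pos2 r2_15 r2_16 r2_17 double_pronic_Suc[of p] unfolding s'
      by (simp add: position_post_def main_inv_def position_inv_def)
  qed (simp add: position_post_def)
  have "terminates position_com s (cost (com.Const 18 0) + ((50 * q + 50) + ((50 * q + 50) + cost position_post)))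
      (main_inv q m (Suc p))"
    unfolding position_com_def
    by (intro terminates_Seq[OF t0] terminates_Seq[OF t1] terminates_Seq[OF t2] t3)
  then show ?thesis
    by (rule terminates_mono) (auto simp: position_post_def)
qed

section \<open>Correctness of the output and total running time\<close>

context tested
begin

text \<open>With at least two defectives, \<open>x < y\<close> are two distinct ones, shifted by
  one; the sum then tells whether there is a third and which.\<close>

lemma outputs_decode:
  assumes "main_inv q m q s"
  shows "outputs (run output_com s) D"
proof -
  define x y where "x = Min (insert (2 ^ q) (singles m q q))" and "y = Max (insert 0 (singles m q q))"
  obtain r where s: "s = (r, m)" "r 15 = x" "r 16 = y" "r 17 = sum Suc D"
    using assms by (cases s) (auto simp: main_inv_def Max_total x_def y_def)
  note xy = Min_Max_singles[folded x_def y_def]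
  have "card D = 0 \<or> card D = 1 \<or> card D = 2 \<or> card D = 3"
    using card_D by linarith
  then consider "D = {}" | d where "D = {d}"
    | a b where "x = Suc a" "y = Suc b" "D = {a, b}" "a \<noteq> b"
    | a b c where "x = Suc a" "y = Suc b" "D = {a, b, c}" "a \<noteq> b" "a \<noteq> c" "b \<noteq> c"
  proof (elim disjE)
    assume "card D = 2"
    then have "D \<noteq> {}" by auto
    with \<open>card D = 2\<close> have "x < y" using xy(3) by simp
    with xy \<open>D \<noteq> {}\<close> obtain a b where ab: "x = Suc a" "y = Suc b" "a \<in> D" "b \<in> D" "a < b" by auto
    with \<open>card D = 2\<close> have "D = {a, b}" by (auto simp: card_2_iff)
    with ab that(3) show ?thesis by auto
  next
    assume "card D = 3"
    then have "D \<noteq> {}" by auto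
    with \<open>card D = 3\<close> have "x < y" using xy(3) by simp
    with xy \<open>D \<noteq> {}\<close> obtain a b where ab: "x = Suc a" "y = Suc b" "a \<in> D" "b \<in> D" "a < b" by auto
    with \<open>card D = 3\<close> have "card (D - {a, b}) = 1" by (simp add: card_Diff_subset)
    then obtain c where "D - {a, b} = {c}" by (auto simp: card_1_singleton_iff)
    with ab have "D = {a, b, c}" "a \<noteq> c" "b \<noteq> c" by auto
    with ab that(4) show ?thesis by auto
  qed (use finite_D in \<open>auto simp: card_1_singleton_iff\<close>)
  then show ?thesis
  proof cases
    case 1
    \<comment> \<open>Without singles, register 16 still holds its initial 0.\<close>
    then have "singles m q q = {}" using singles_subset by simp
    then have "y = 0" by (simp add: y_def)
    with 1 s show ?thesis by (simp add: outputs_def output_com_def bij_betw_def)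
  next
    case (2 d)
    then have "x = Suc d" "y = Suc d" using xy by auto
    with 2 s show ?thesis by (simp add: outputs_def output_com_def bij_betw_def lessThan_Suc)
  next
    case (3 a b)
    then have "a < b" using xy(3) by auto
    with 3 s show ?thesis
      by (auto simp: outputs_def output_com_def bij_betw_def lessThan_Suc numeral_2_eq_2)
  next
    case (4 a b c)
    then have "a < b" using xy(3) by auto
    with 4 s show ?thesis
      by (auto simp: outputs_def output_com_def bij_betw_def lessThan_Suc numeral_2_eq_2 numeral_3_eq_3)
  qed
qed

lemma terminates_decode:
  assumes "r 0 = 2 ^ q"
  shows "terminates decode (r, m) (300 * q\<^sup>2) (\<lambda>s. outputs s D)"
proof -
  have start: "terminates start_com (r, m) (cost start_com) (main_inv q m 0)"
    by (rule terminates_run)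
      (use assms in \<open>auto simp: start_com_def main_inv_def position_inv_def singles_def\<close>)
  have loop: "terminates (While 14 position_com) s (q * Suc (100 * q + 120) + 1) (main_inv q m q)"
    if "main_inv q m 0 s" for s
  proof (rule terminates_While[where I = "main_inv q m", OF _ _ that])
    fix p s assume p: "p < q" "main_inv q m p s"
    have "fst s 14 \<noteq> 0"
      using p by (auto simp: main_inv_def position_inv_def)
    with terminates_position[OF p(2)]
    show "fst s 14 \<noteq> 0 \<and> terminates position_com s (100 * q + 120) (main_inv q m (Suc p))"
      by blast
  qed (auto simp: main_inv_def position_inv_def)
  have out: "terminates output_com s (cost output_com) (\<lambda>s. outputs s D)" if "main_inv q m q s" for s
    by (rule terminates_run) (simp add: output_com_def, rule outputs_decode[OF that])
  have "terminates decode (r, m)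
      (cost start_com + ((q * Suc (100 * q + 120) + 1) + cost output_com)) (\<lambda>s. outputs s D)"
    unfolding decode_def
    by (intro terminates_Seq[OF start] terminates_Seq[OF loop] out)
  moreover have "cost start_com + ((q * Suc (100 * q + 120) + 1) + cost output_com) \<le> 300 * q\<^sup>2"
  proof -
    \<comment> \<open>These absorb the linear term \<open>121 * q\<close> into
      \<open>61 * q\<^sup>2\<close> and the constant 41 into \<open>11 * q\<^sup>2\<close>.\<close>
    have "2 * q \<le> q\<^sup>2" "4 \<le> q\<^sup>2"
      using q mult_le_mono[OF q q] by (simp_all add: power2_eq_square)
    moreover have "q * Suc (100 * q + 120) = 100 * q\<^sup>2 + 121 * q"
      by (simp add: power2_eq_square algebra_simps)
    moreover have "cost start_com + cost output_com \<le> 40"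
      by (simp add: start_com_def output_com_def)
    ultimately show ?thesis by linarith
  qed
  ultimately show ?thesis
    by (rule terminates_mono)
qed

end

section \<open>Application to the matrix: separability and linear time\<close>

lemma terminates_decode_input:
  assumes "2 \<le> q" and "D \<in> selections 3 (bit_pair_matrix q)"
  shows "terminates decode
    (input_state (dim_col (bit_pair_matrix q)) (boolean_sum (bit_pair_matrix q) D))
    (300 * q\<^sup>2) (\<lambda>s. outputs s D)"
proof -
  let ?v = "boolean_sum (bit_pair_matrix q) D"
  define m :: "nat \<Rightarrow> nat" where "m = (\<lambda>a. if a < dim_vec ?v \<and> ?v $ a then 1 else 0)"
  have D: "D \<subseteq> {..<2 ^ q}" "card D \<le> 3"
    using assms(2) by (auto simp: selections_def bit_pair_matrix_def)
  have "represents q m D"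
    unfolding represents_def m_def using boolean_sum_test_row[OF _ _ D(1)] by auto
  with assms(1) D interpret tested q m D by unfold_locales
  show ?thesis
    unfolding input_state_def m_def[symmetric]
    by (rule terminates_decode) (simp add: bit_pair_matrix_def)
qed

text \<open>Equal outcomes give equal input states, hence by determinism the same final state, and a
  state outputs only one set.\<close>

lemma analysis_algorithm_imp_bar_separable:
  assumes "analysis_algorithm d M c"
  shows "bar_separable d M"
  unfolding bar_separable_def
proof (rule inj_onI)
  fix D E assume sel: "D \<in> selections d M" "E \<in> selections d M"
    and eq: "boolean_sum M D = boolean_sum M E"
  from assms sel(1) obtain k s where
    "exec c (input_state (dim_col M) (boolean_sum M D)) k s" "outputs s D"
    unfolding analysis_algorithm_def by blast
  moreover from assms sel(2) obtain l u where
    "exec c (input_state (dim_col M) (boolean_sum M D)) l u" "outputs u E"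
    unfolding analysis_algorithm_def eq by blast
  ultimately have "outputs s D" "outputs s E"
    using exec_deterministic by blast+
  then show "D = E"
    by (cases s) (simp add: outputs_def bij_betw_def)
qed

lemma running_time_eq: "exec c s k s' \<Longrightarrow> running_time c s = k"
  unfolding running_time_def using exec_deterministic by blast

lemma analysis_time_decode:
  assumes "2 \<le> q"
  shows "analysis_time 3 (bit_pair_matrix q) decode \<le> 300 * q\<^sup>2"
proof -
  let ?S = "selections 3 (bit_pair_matrix q)"
  have "finite ?S"
    by (rule finite_subset[of _ "Pow {..<dim_col (bit_pair_matrix q)}"])
      (auto simp: selections_def)
  moreover have "{} \<in> ?S" by (simp add: selections_def)
  moreover have "running_time decode
      (input_state (dim_col (bit_pair_matrix q)) (boolean_sum (bit_pair_matrix q) D)) \<le> 300 * q\<^sup>2"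
    if "D \<in> ?S" for D
    using terminates_decode_input[OF assms that] by (auto simp: terminates_def running_time_eq)
  ultimately show ?thesis
    unfolding analysis_time_def by (subst Max_le_iff) auto
qed

theorem theorem4:
  "\<exists>(M :: nat \<Rightarrow> bool mat) (c :: com).
    (\<forall>q\<ge>2. M q \<in> carrier_mat (2 * q\<^sup>2 - 2 * q) (2 ^ q) \<and> bar_separable 3 (M q) \<and>
      analysis_algorithm 3 (M q) c) \<and>
    time_optimal 3 M c"
proof (intro exI conjI allI impI)
  fix q :: nat assume q: "2 \<le> q"
  show "bit_pair_matrix q \<in> carrier_mat (2 * q\<^sup>2 - 2 * q) (2 ^ q)"
    by (simp add: bit_pair_matrix_def)
  show "analysis_algorithm 3 (bit_pair_matrix q) decode"
    using terminates_decode_input[OF q] by (fastforce simp: analysis_algorithm_def terminates_def)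
  then show "bar_separable 3 (bit_pair_matrix q)"
    by (rule analysis_algorithm_imp_bar_separable)
next
  show "time_optimal 3 bit_pair_matrix decode"
    unfolding time_optimal_def
  proof (rule bigoI[of _ 300], rule eventually_sequentiallyI)
    fix q :: nat assume q: "2 \<le> q"
    \<comment> \<open>Since \<open>2 * q \<le> q\<^sup>2\<close>, there are at least
      \<open>q\<^sup>2\<close> rows, so time quadratic in \<open>q\<close> is linear in the number
      of tests.\<close>
    have "q\<^sup>2 \<le> 2 * q\<^sup>2 - 2 * q"
      using mult_le_mono1[OF q, of q] unfolding power2_eq_square by linarith
    then have "300 * q\<^sup>2 \<le> 300 * dim_row (bit_pair_matrix q)"
      by (simp add: bit_pair_matrix_def)
    with analysis_time_decode[OF q]
    have "analysis_time 3 (bit_pair_matrix q) decode \<le> 300 * dim_row (bit_pair_matrix q)"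
      by (rule order_trans)
    then show "norm (real (analysis_time 3 (bit_pair_matrix q) decode))
        \<le> 300 * norm (real (dim_row (bit_pair_matrix q)))"
      by (simp flip: of_nat_mult)
  qed
qed

end
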